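(* Let $X=\{1,\dots,n\}$ be the vertex set of the complete graph on $n$ vertices and let $\mathcal{M}_X$ be the Markov operator of the vertex lamplighter random walk on $X$. There exists a constant $C>0$, independent of $n$, $k$, $c$ and the starting point, such that if $k\ge\frac n2(\log n+c)$ with $c\ge0$, then for $\omega_0\in\{0,1\}^X$ and $y\in X$ we have \[ \Big\|\mathcal{M}_X^k(\delta_{\omega_0}\otimes\delta_y)-\frac{1}{2^n n}\mathbf{1}_{\mathcal{L}(X)}\Big\|_{TV}^2\le C\exp(-c). \]
   Context: In the complete graph, $x\sim y$ iff $x\neq y$, and $\deg(x)=n-1$. Let $\mathcal{L}(X)=\{0,1\}^X\times X$, with the graph structure in which $(\omega,x)$ and $(\theta,y)$ are adjacent iff $x\ne y$ and $\omega(z)=\theta(z)$ for all $z\ne x,y$. The vertex lamplighter random walk is the simple random walk on this ($4(n-1)$-regular) graph, and its Markov operator is $(\mathcal{M}_X\Phi)(\omega,x)=\frac{1}{4(n-1)}\sum_{(\theta,y)}\Phi(\theta,y)$, summed over the neighbours $(\theta,y)$ of $(\omega,x)$, for complex functions $\Phi$ on $\mathcal{L}(X)$. The function $\delta_{\omega_0}\otimes\delta_y$ is the point mass at $(\omega_0,y)$, so $\mathcal{M}_X^k(\delta_{\omega_0}\otimes\delta_y)$ is the distribution after $k$ steps starting from $(\omega_0,y)$; $\mathbf{1}_{\mathcal{L}(X)}$ is the constant function $1$. For probability distributions $p,q$ on a finite set $Y$, $\|p-q\|_{TV}=\max_{A\subseteq Y}|p(A)-q(A)|$. $\log$ is the natural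 logarithm and $k$ is an integer.
   Formalization: The formal statement assumes n ≥ 3: for n = 1 the Markov operator is undefined (division by n−1 = 0), and for n = 2 the walker alternates between the two vertices, so the distance stays at least 1/2 and no constant C works as c grows. *)

theory Defs
  imports Complex_Main "HOL-Library.FuncSet"
begin

definition lamp_states :: "'a set \<Rightarrow> (('a \<Rightarrow> nat) \<times> 'a) set" where
  "lamp_states X = (X \<rightarrow>\<^sub>E {0, 1}) \<times> X"

text \<open>
  Adjacency in the lamplighter graph over the complete graph on \<open>X\<close>. It is only meant to be
  used between two members of \<^term>\<open>lamp_states X\<close>.
\<close>

definition lamp_adj :: "'a set \<Rightarrow> ('a \<Rightarrow> nat) \<times> 'a \<Rightarrow> ('a \<Rightarrow> nat) \<times> 'a \<Rightarrow> bool" where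
  "lamp_adj X = (\<lambda>(\<omega>, x) (\<theta>, y). x \<noteq> y \<and> (\<forall>z \<in> X - {x, y}. \<omega> z = \<theta> z))"

text \<open>
  A function on the state space is a total function of which only the values on
  \<^term>\<open>lamp_states X\<close> matter: the sum below ranges over neighbours inside the state space, so
  iterating the operator never reads a value outside it.
\<close>

definition lamp_op ::
  "'a set \<Rightarrow> (('a \<Rightarrow> nat) \<times> 'a \<Rightarrow> complex) \<Rightarrow> ('a \<Rightarrow> nat) \<times> 'a \<Rightarrow> complex" where
  "lamp_op X \<Phi> p =
     1 / (4 * (of_nat (card X) - 1)) * (\<Sum>q \<in> {q \<in> lamp_states X. lamp_adj X p q}. \<Phi> q)"

definition point_mass :: "'b \<Rightarrow> 'b \<Rightarrow> complex" where
  "point_mass a b = (if b = a then 1 else 0)"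

text \<open>
  Distributions are complex valued here because the Markov operator acts on complex functions,
  hence the norm in place of the absolute value.
\<close>

definition tv_dist :: "'b set \<Rightarrow> ('b \<Rightarrow> complex) \<Rightarrow> ('b \<Rightarrow> complex) \<Rightarrow> real" where
  "tv_dist Y p q = Max ((\<lambda>A. norm ((\<Sum>a\<in>A. p a) - (\<Sum>a\<in>A. q a))) ` Pow Y)"

end

theory Submission
  imports Defs "HOL-Analysis.Convex"
begin

text \<open>
  A step of the walk rerandomises the lamps at both of its endpoints, so expanding in the characters
  \<open>\<chi>\<^sub>A\<close> of \<open>{0,1}\<^sup>X\<close> decouples the lamps: the coefficient of \<open>\<chi>\<^sub>A\<close> evolves as the walk on the
  complete graph killed on \<open>A\<close>, which is explicit. By Cauchy-Schwarz and Plancherel the squared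
  total variation distance is at most a sum over \<open>A\<close> of squared coefficients. With \<open>a = |A|\<close>, the
  term of \<open>A \<noteq> {}\<close> is at most \<open>2(a+1)(1-a/(n-1))\<^bsup>2k\<^esup> \<le> 2(2e\<^bsup>-c\<^esup>/n)\<^sup>a\<close>, so these terms sum to at most
  \<open>2((1+2e\<^bsup>-c\<^esup>/n)\<^bsup>n-1\<^esup> - 1) = O(e\<^bsup>-c\<^esup>)\<close>.
\<close>

section \<open>Characters of the cube of lamp configurations\<close>

text \<open>The Walsh functions: identifying \<open>{0, 1}\<close> with the group of order two,
  these are the characters of the group of configurations.\<close>

definition chi :: "'a set \<Rightarrow> ('a \<Rightarrow> nat) \<Rightarrow> real" where
  "chi A \<omega> = (\<Prod>z\<in>A. (-1) ^ \<omega> z)"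

lemma chi_square [simp]: "chi A \<omega> * chi A \<omega> = 1"
  by (simp add: chi_def flip: prod.distrib power_mult_distrib)

lemma chi_update_notin: "x \<notin> A \<Longrightarrow> chi A (\<omega>(x := a)) = chi A \<omega>"
  unfolding chi_def by (rule prod.cong) auto

text \<open>Flipping the lamp at \<open>x\<close> negates \<open>chi A\<close> when \<open>x\<close>
  lies in \<open>A\<close> and does not affect it otherwise. This cancellation is the source of the
  killing.\<close>

lemma sum_chi_update:
  assumes "finite A"
  shows "(\<Sum>a\<in>{0, 1}. chi A (\<omega>(x := a))) = (if x \<in> A then 0 else 2 * chi A \<omega>)"
proof (cases "x \<in> A")
  case True
  have "chi A (\<omega>(x := a)) = (-1) ^ a * chi (A - {x}) \<omega>" for a
  proof -
    have "chi A (\<omega>(x := a)) = (-1) ^ a * chi (A - {x}) (\<omega>(x := a))"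
      unfolding chi_def using True assms by (subst prod.remove[of _ x]) auto
    then show ?thesis by (simp add: chi_update_notin)
  qed
  then show ?thesis using True by simp
qed (simp add: chi_update_notin)

text \<open>Multiplying out the product selects a subset. For constant \<open>f\<close> this is the
  binomial theorem in the form used for the final summation.\<close>

lemma sum_prod_Pow:
  fixes f :: "'a \<Rightarrow> real"
  assumes "finite X"
  shows "(\<Sum>A\<in>Pow X. \<Prod>z\<in>A. f z) = (\<Prod>z\<in>X. 1 + f z)"
  using prod_add[OF assms, of f "\<lambda>_. 1"] by (simp add: add.commute)

text \<open>The sum factorises over the lamps, and a lamp at which the configurations differ
  contributes the factor \<open>1 - 1\<close>. This gives the expansion of a point mass in
  characters.\<close>

lemma chi_completeness:
  assumes "finite X" "\<omega> \<in> X \<rightarrow>\<^sub>E {0, 1}" "\<theta> \<in> X \<rightarrow>\<^sub>E {0, 1}"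
  shows "(\<Sum>A\<in>Pow X. chi A \<omega> * chi A \<theta>) = (if \<omega> = \<theta> then 2 ^ card X else 0)"
proof -
  have "(\<Sum>A\<in>Pow X. chi A \<omega> * chi A \<theta>) = (\<Prod>z\<in>X. 1 + (-1) ^ \<omega> z * (-1) ^ \<theta> z)"
    using sum_prod_Pow[OF assms(1)] by (simp add: chi_def flip: prod.distrib)
  also have "\<dots> = (if \<omega> = \<theta> then 2 ^ card X else 0)"
  proof (cases "\<omega> = \<theta>")
    case True
    then show ?thesis by (simp flip: power_mult_distrib)
  next
    case False
    then obtain z where z: "z \<in> X" "\<omega> z \<noteq> \<theta> z"
      using assms PiE_ext by blast
    have "\<omega> z \<in> {0, 1}" "\<theta> z \<in> {0, 1}"
      using assms z by blast+
    with z have "1 + (-1) ^ \<omega> z * (-1) ^ \<theta> z = (0::real)"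
      by auto
    then show ?thesis
      using False z assms(1) by (auto intro!: prod_zero)
  qed
  finally show ?thesis .
qed

text \<open>Again the sum factorises over the lamps; a lamp lying in exactly one of \<open>A\<close>
  and \<open>B\<close> contributes \<open>1 + (-1) = 0\<close>, any other contributes 2.\<close>

lemma chi_orthogonality:
  assumes "finite X" "A \<subseteq> X" "B \<subseteq> X"
  shows "(\<Sum>\<omega>\<in>X \<rightarrow>\<^sub>E {0, 1}. chi A \<omega> * chi B \<omega>) = (if A = B then 2 ^ card X else 0)"
proof -
  \<comment> \<open>Padding with ones lets both characters be products over all of \<open>X\<close>,
    as the exchange of product and sum requires.\<close>
  define h :: "'a \<Rightarrow> nat \<Rightarrow> real" where
    "h z i = (if z \<in> A then (-1) ^ i else 1) * (if z \<in> B then (-1) ^ i else 1)" for z i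
  have chi: "chi C \<omega> = (\<Prod>z\<in>X. if z \<in> C then (-1) ^ \<omega> z else 1)" if "C \<subseteq> X" for C \<omega>
    unfolding chi_def using that assms(1) by (intro prod.mono_neutral_cong_left) auto
  have "(\<Sum>\<omega>\<in>X \<rightarrow>\<^sub>E {0, 1}. chi A \<omega> * chi B \<omega>) = (\<Sum>\<omega>\<in>X \<rightarrow>\<^sub>E {0, 1}. \<Prod>z\<in>X. h z (\<omega> z))"
    by (simp add: chi assms h_def prod.distrib)
  also have "\<dots> = (\<Prod>z\<in>X. \<Sum>i\<in>{0, 1}. h z i)"
    by (rule prod_sum_PiE[symmetric]) (use assms in auto)
  also have "\<dots> = (\<Prod>z\<in>X. if (z \<in> A) = (z \<in> B) then 2 else 0)"
    by (rule prod.cong) (auto simp: h_def)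
  also have "\<dots> = (if A = B then 2 ^ card X else 0)"
  proof (cases "A = B")
    case False
    then obtain z where "z \<in> X" "(z \<in> A) \<noteq> (z \<in> B)"
      using assms by blast
    then show ?thesis
      using False assms(1) by (auto intro!: prod_zero)
  qed simp
  finally show ?thesis .
qed

lemma chi_Plancherel:
  assumes "finite X"
  shows "(\<Sum>\<omega>\<in>X \<rightarrow>\<^sub>E {0, 1}. (\<Sum>A\<in>Pow X. chi A \<omega> * c A)\<^sup>2) = 2 ^ card X * (\<Sum>A\<in>Pow X. (c A)\<^sup>2)"
proof -
  have "(\<Sum>\<omega>\<in>X \<rightarrow>\<^sub>E {0, 1}. (\<Sum>A\<in>Pow X. chi A \<omega> * c A)\<^sup>2)
      = (\<Sum>\<omega>\<in>X \<rightarrow>\<^sub>E {0, 1}. \<Sum>A\<in>Pow X. \<Sum>B\<in>Pow X. c A * c B * (chi A \<omega> * chi B \<omega>))"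
    by (simp add: power2_eq_square sum_product mult_ac)
  also have "\<dots> = (\<Sum>A\<in>Pow X. \<Sum>\<omega>\<in>X \<rightarrow>\<^sub>E {0, 1}. \<Sum>B\<in>Pow X. c A * c B * (chi A \<omega> * chi B \<omega>))"
    by (rule sum.swap)
  also have "\<dots> = (\<Sum>A\<in>Pow X. \<Sum>B\<in>Pow X. \<Sum>\<omega>\<in>X \<rightarrow>\<^sub>E {0, 1}. c A * c B * (chi A \<omega> * chi B \<omega>))"
    by (intro sum.cong refl sum.swap)
  also have "\<dots> = (\<Sum>A\<in>Pow X. \<Sum>B\<in>Pow X. if A = B then c A * c B * 2 ^ card X else 0)"
  proof (intro sum.cong refl)
    fix A B assume "A \<in> Pow X" "B \<in> Pow X"
    then have "(\<Sum>\<omega>\<in>X \<rightarrow>\<^sub>E {0, 1}. chi A \<omega> * chi B \<omega>) = (if A = B then 2 ^ card X else 0)"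
      by (intro chi_orthogonality assms) auto
    then show "(\<Sum>\<omega>\<in>X \<rightarrow>\<^sub>E {0, 1}. c A * c B * (chi A \<omega> * chi B \<omega>))
        = (if A = B then c A * c B * 2 ^ card X else 0)"
      unfolding sum_distrib_left[symmetric] by simp
  qed
  also have "\<dots> = 2 ^ card X * (\<Sum>A\<in>Pow X. (c A)\<^sup>2)"
    using assms by (simp add: sum_distrib_left power2_eq_square mult_ac)
  finally show ?thesis .
qed

section \<open>The state space and the walk operator on characters\<close>

lemma finite_lamp_states: "finite X \<Longrightarrow> finite (lamp_states X)"
  by (simp add: lamp_states_def finite_PiE)

lemma card_lamp_states: "finite X \<Longrightarrow> card (lamp_states X) = 2 ^ card X * card X"
  by (simp add: lamp_states_def card_cartesian_product card_PiE numeral_2_eq_2)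

text \<open>A neighbour is determined by its position \<open>y\<close> and its two lamp values at
  \<open>x\<close> and \<open>y\<close>, all freely chosen; hence the degree
  \<open>4 (n - 1)\<close>.\<close>

lemma sum_lamp_neighbours:
  assumes "finite X" "(\<omega>, x) \<in> lamp_states X"
  shows "(\<Sum>q\<in>{q \<in> lamp_states X. lamp_adj X (\<omega>, x) q}. \<Phi> q)
       = (\<Sum>y\<in>X - {x}. \<Sum>a\<in>{0, 1}. \<Sum>b\<in>{0, 1}. \<Phi> (\<omega>(x := a, y := b), y))"
proof -
  let ?S = "(X - {x}) \<times> {0, 1} \<times> {0, 1::nat}"
  have \<omega>: "\<omega> \<in> X \<rightarrow>\<^sub>E {0, 1}" "x \<in> X"
    using assms by (auto simp: lamp_states_def)
  \<comment> \<open>Outside \<open>X\<close> both configurations are \<open>undefined\<close>, so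
    agreement on \<open>X - {x, y}\<close> suffices.\<close>
  have upd: "\<omega>(x := \<theta> x, y := \<theta> y) = \<theta>"
    if "(\<theta>, y) \<in> lamp_states X" "lamp_adj X (\<omega>, x) (\<theta>, y)" for \<theta> y
  proof
    fix z
    have \<theta>: "\<theta> \<in> X \<rightarrow>\<^sub>E {0, 1}"
      using that(1) by (simp add: lamp_states_def)
    have "z \<notin> X \<Longrightarrow> \<omega> z = \<theta> z"
      using PiE_arb[OF \<omega>(1)] PiE_arb[OF \<theta>] by simp
    moreover have "z \<in> X - {x, y} \<Longrightarrow> \<omega> z = \<theta> z"
      using that(2) by (simp add: lamp_adj_def)
    ultimately show "(\<omega>(x := \<theta> x, y := \<theta> y)) z = \<theta> z"
      by (cases "z = x"; cases "z = y"; cases "z \<in> X") simp_all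
  qed
  have "(\<Sum>q\<in>{q \<in> lamp_states X. lamp_adj X (\<omega>, x) q}. \<Phi> q)
      = (\<Sum>(y, a, b)\<in>?S. \<Phi> (\<omega>(x := a, y := b), y))"
  proof (rule sum.reindex_bij_witness[where i = "\<lambda>(y, a, b). (\<omega>(x := a, y := b), y)"
        and j = "\<lambda>(\<theta>, y). (y, \<theta> x, \<theta> y)"], goal_cases)
    case (1 q)
    then show ?case using upd by (cases q) auto
  next
    case (2 q)
    then show ?case using \<omega>(2) by (auto simp: lamp_states_def lamp_adj_def dest: PiE_mem)
  next
    case (4 b)
    then obtain y a c where b: "b = (y, a, c)" "y \<in> X - {x}" "a \<in> {0, 1}" "c \<in> {0, 1}"
      by blast
    then have "\<omega>(x := a, y := c) \<in> X \<rightarrow>\<^sub>E {0, 1}"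
      using PiE_fun_upd[of c "\<lambda>_. {0, 1}" y "\<omega>(x := a)" X] PiE_fun_upd[of a "\<lambda>_. {0, 1}" x \<omega> X] \<omega>
      by (simp add: insert_absorb)
    then show ?case
      using b(1,2) by (auto simp: lamp_states_def lamp_adj_def)
  next
    case (5 q)
    then show ?case using upd by (cases q) auto
  qed (auto simp: fun_upd_def)
  also have "\<dots> = (\<Sum>y\<in>X - {x}. \<Sum>a\<in>{0, 1}. \<Sum>b\<in>{0, 1}. \<Phi> (\<omega>(x := a, y := b), y))"
    by (simp only: sum.cartesian_product)
  finally show ?thesis .
qed

lemma lamp_op_cong:
  assumes "\<And>q. q \<in> lamp_states X \<Longrightarrow> \<Phi> q = \<Psi> q"
  shows "lamp_op X \<Phi> p = lamp_op X \<Psi> p"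
  unfolding lamp_op_def by (simp add: assms)

text \<open>For \<open>k > 0\<close> this is the probability that simple random walk on the complete
  graph goes from \<open>y\<close> to \<open>x\<close> in \<open>k\<close> steps avoiding
  \<open>A\<close> at all times, both ends included. At time 0 nothing is killed yet, even if
  \<open>y\<close> lies in \<open>A\<close>, because the point mass has a nonzero coefficient at
  every character.\<close>

primrec killed :: "'a set \<Rightarrow> 'a set \<Rightarrow> 'a \<Rightarrow> nat \<Rightarrow> 'a \<Rightarrow> real" where
  "killed X A y 0 x = of_bool (x = y)"
| "killed X A y (Suc k) x =
     (if x \<in> A then 0 else (\<Sum>z\<in>X - A - {x}. killed X A y k z) / (real (card X) - 1))"

text \<open>If an endpoint of the step lies in \<open>A\<close>, the four lamp choices cancel;
  otherwise all four return \<open>chi A \<omega>\<close>, and the 4 cancels against the degree.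
  What is left is one step of the recursion of \<open>killed\<close>.\<close>

lemma lamp_op_chi:
  assumes "finite X" "A \<subseteq> X" "(\<omega>, x) \<in> lamp_states X"
  shows "lamp_op X (\<lambda>(\<theta>, z). complex_of_real (chi A \<theta> * \<phi> z)) (\<omega>, x)
    = complex_of_real (chi A \<omega> *
        (if x \<in> A then 0 else (\<Sum>z\<in>X - A - {x}. \<phi> z) / (real (card X) - 1)))"
proof -
  have fA: "finite A"
    using assms finite_subset by blast
  have lamps: "(\<Sum>a\<in>{0, 1}. \<Sum>b\<in>{0, 1}. chi A (\<omega>(x := a, z := b)))
      = (if x \<in> A \<or> z \<in> A then 0 else 4 * chi A \<omega>)" for z
  proof -
    have "(\<Sum>a\<in>{0, 1}. \<Sum>b\<in>{0, 1}. chi A (\<omega>(x := a, z := b)))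
        = (\<Sum>a\<in>{0, 1}. if z \<in> A then 0 else 2 * chi A (\<omega>(x := a)))"
      by (simp only: sum_chi_update[OF fA])
    also have "\<dots> = (if z \<in> A then 0 else 2 * (\<Sum>a\<in>{0, 1}. chi A (\<omega>(x := a))))"
      by (simp add: sum_distrib_left)
    also have "\<dots> = (if x \<in> A \<or> z \<in> A then 0 else 4 * chi A \<omega>)"
      unfolding sum_chi_update[OF fA] by auto
    finally show ?thesis .
  qed
  have "(\<Sum>z\<in>X - {x}. \<Sum>a\<in>{0, 1}. \<Sum>b\<in>{0, 1}. chi A (\<omega>(x := a, z := b)) * \<phi> z)
      = (\<Sum>z\<in>X - {x}. (\<Sum>a\<in>{0, 1}. \<Sum>b\<in>{0, 1}. chi A (\<omega>(x := a, z := b))) * \<phi> z)"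
    by (simp add: sum_distrib_right del: sum.insert)
  also have "\<dots> = (\<Sum>z\<in>X - {x}. if x \<in> A \<or> z \<in> A then 0 else 4 * chi A \<omega> * \<phi> z)"
    unfolding lamps by (rule sum.cong) auto
  also have "\<dots> = (\<Sum>z\<in>X - A - {x}. if x \<in> A then 0 else 4 * chi A \<omega> * \<phi> z)"
    by (rule sum.mono_neutral_cong_right) (use assms in auto)
  also have "\<dots> = (if x \<in> A then 0 else 4 * chi A \<omega> * (\<Sum>z\<in>X - A - {x}. \<phi> z))"
    by (simp add: sum_distrib_left)
  finally have sum: "(\<Sum>z\<in>X - {x}. \<Sum>a\<in>{0, 1}. \<Sum>b\<in>{0, 1}. chi A (\<omega>(x := a, z := b)) * \<phi> z)
      = (if x \<in> A then 0 else 4 * chi A \<omega> * (\<Sum>z\<in>X - A - {x}. \<phi> z))" .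
  have "lamp_op X (\<lambda>(\<theta>, z). complex_of_real (chi A \<theta> * \<phi> z)) (\<omega>, x)
      = 1 / (4 * (of_nat (card X) - 1)) * complex_of_real
        (\<Sum>z\<in>X - {x}. \<Sum>a\<in>{0, 1}. \<Sum>b\<in>{0, 1}. chi A (\<omega>(x := a, z := b)) * \<phi> z)"
    unfolding lamp_op_def sum_lamp_neighbours[OF assms(1,3)] prod.case of_real_sum ..
  also have "\<dots> = complex_of_real (1 / (4 * (real (card X) - 1)) *
      (if x \<in> A then 0 else 4 * chi A \<omega> * (\<Sum>z\<in>X - A - {x}. \<phi> z)))"
    unfolding sum by simp
  also have "1 / (4 * (real (card X) - 1)) *
      (if x \<in> A then 0 else 4 * chi A \<omega> * (\<Sum>z\<in>X - A - {x}. \<phi> z))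
      = chi A \<omega> * (if x \<in> A then 0 else (\<Sum>z\<in>X - A - {x}. \<phi> z) / (real (card X) - 1))"
    by (simp add: divide_simps)
  finally show ?thesis .
qed

lemma lamp_op_sum:
  "lamp_op X (\<lambda>q. \<Sum>i\<in>I. \<Phi> i q) p = (\<Sum>i\<in>I. lamp_op X (\<Phi> i) p)"
proof -
  have "(\<Sum>q\<in>{q \<in> lamp_states X. lamp_adj X p q}. \<Sum>i\<in>I. \<Phi> i q)
      = (\<Sum>i\<in>I. \<Sum>q\<in>{q \<in> lamp_states X. lamp_adj X p q}. \<Phi> i q)"
    by (rule sum.swap)
  then show ?thesis
    by (simp add: lamp_op_def sum_distrib_left)
qed

text \<open>Completeness gives the case \<open>k = 0\<close>. The operator does not mix different
  characters, so each coefficient then evolves on its own by \<open>lamp_op_chi\<close>.\<close>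

lemma lamp_op_power_point_mass:
  assumes "finite X" "\<omega>\<^sub>0 \<in> X \<rightarrow>\<^sub>E {0, 1}" "(\<omega>, x) \<in> lamp_states X"
  shows "(lamp_op X ^^ k) (point_mass (\<omega>\<^sub>0, y)) (\<omega>, x) = complex_of_real
    (\<Sum>A\<in>Pow X. chi A \<omega> * (chi A \<omega>\<^sub>0 / 2 ^ card X * killed X A y k x))"
  using assms(3)
proof (induction k arbitrary: \<omega> x)
  case 0
  then have "\<omega> \<in> X \<rightarrow>\<^sub>E {0, 1}"
    by (simp add: lamp_states_def)
  then have "(\<Sum>A\<in>Pow X. chi A \<omega> * chi A \<omega>\<^sub>0) = (if \<omega> = \<omega>\<^sub>0 then 2 ^ card X else 0)"
    by (rule chi_completeness[OF assms(1) _ assms(2)])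
  moreover have "(\<Sum>A\<in>Pow X. chi A \<omega> * (chi A \<omega>\<^sub>0 / 2 ^ card X * killed X A y 0 x))
      = (\<Sum>A\<in>Pow X. chi A \<omega> * chi A \<omega>\<^sub>0) / 2 ^ card X * of_bool (x = y)"
    by (simp add: sum_divide_distrib sum_distrib_right)
  ultimately show ?case
    by (auto simp: point_mass_def)
next
  case (Suc k)
  define c where "c A z = chi A \<omega>\<^sub>0 / 2 ^ card X * killed X A y k z" for A z
  have "(lamp_op X ^^ Suc k) (point_mass (\<omega>\<^sub>0, y)) (\<omega>, x)
      = lamp_op X ((lamp_op X ^^ k) (point_mass (\<omega>\<^sub>0, y))) (\<omega>, x)"
    by simp
  also have "\<dots> = lamp_op X (\<lambda>q. \<Sum>A\<in>Pow X.
      (\<lambda>(\<theta>, z). complex_of_real (chi A \<theta> * c A z)) q) (\<omega>, x)"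
    by (rule lamp_op_cong) (auto simp: Suc.IH c_def)
  also have "\<dots> = (\<Sum>A\<in>Pow X. lamp_op X (\<lambda>(\<theta>, z). complex_of_real (chi A \<theta> * c A z)) (\<omega>, x))"
    by (rule lamp_op_sum)
  also have "\<dots> = (\<Sum>A\<in>Pow X. complex_of_real
      (chi A \<omega> * (chi A \<omega>\<^sub>0 / 2 ^ card X * killed X A y (Suc k) x)))"
  proof (intro sum.cong refl)
    fix A assume "A \<in> Pow X"
    then have "A \<subseteq> X" by simp
    then show "lamp_op X (\<lambda>(\<theta>, z). complex_of_real (chi A \<theta> * c A z)) (\<omega>, x)
        = complex_of_real (chi A \<omega> * (chi A \<omega>\<^sub>0 / 2 ^ card X * killed X A y (Suc k) x))"
      unfolding lamp_op_chi[OF assms(1) \<open>A \<subseteq> X\<close> Suc.prems]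
      by (simp add: c_def sum_distrib_left sum_divide_distrib mult_ac)
  qed
  finally show ?case by simp
qed

section \<open>The killed walk: explicit form and sums of squares\<close>

lemma killed_start_in:
  assumes "y \<in> A"
  shows "killed X A y (Suc k) x = 0"
proof (induction k arbitrary: x)
  case 0
  show ?case using assms by (auto intro!: sum.neutral)
next
  case (Suc k)
  have "(\<Sum>z\<in>X - A - {x}. killed X A y (Suc k) z) = 0"
    by (rule sum.neutral) (simp only: Suc.IH, simp)
  then show ?case by (subst killed.simps(2)) simp
qed

text \<open>On the \<open>m\<close> surviving points the unnormalised step is the all-ones matrix
  minus the identity, with eigenvalue \<open>m - 1\<close> on constants and \<open>-1\<close> on
  functions of mean zero. The point mass at \<open>y\<close> is split accordingly.\<close>

lemma killed_explicit:
  assumes "finite X" "A \<subseteq> X" "y \<in> X - A" "x \<in> X - A"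
  defines "m \<equiv> real (card (X - A))"
  shows "killed X A y k x =
    ((m - 1) ^ k / m + (-1) ^ k * (of_bool (x = y) - 1 / m)) / (real (card X) - 1) ^ k"
  using assms(4)
proof (induction k arbitrary: x)
  case 0
  then show ?case by simp
next
  case (Suc k)
  define g where "g z = (m - 1) ^ k / m + (-1) ^ k * (of_bool (z = y) - 1 / m)" for z
  have m0: "m \<noteq> 0"
    using assms by (auto simp: m_def)
  \<comment> \<open>The mean-zero part drops out of the total, and a step sends \<open>g\<close> to
    its total minus its value at \<open>x\<close>.\<close>
  have "(\<Sum>z\<in>X - A. g z) = (m - 1) ^ k + (-1) ^ k * ((\<Sum>z\<in>X - A. of_bool (z = y)) - 1)"
    using m0 by (simp add: g_def sum.distrib sum_subtractf flip: sum_distrib_left m_def)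
  also have "(\<Sum>z\<in>X - A. of_bool (z = y)) = (1::real)"
    using assms by (simp add: of_bool_def)
  finally have "(\<Sum>z\<in>X - A - {x}. g z) = (m - 1) ^ k - g x"
    using Suc.prems assms(1) by (simp add: sum_diff1)
  also have "\<dots> = (m - 1) ^ Suc k / m + (-1) ^ Suc k * (of_bool (x = y) - 1 / m)"
    using m0 by (simp add: g_def field_simps)
  finally have "(\<Sum>z\<in>X - A - {x}. killed X A y k z)
      = ((m - 1) ^ Suc k / m + (-1) ^ Suc k * (of_bool (x = y) - 1 / m)) / (real (card X) - 1) ^ k"
    by (simp add: Suc.IH g_def flip: sum_divide_distrib)
  then show ?case
    using Suc.prems by (simp add: mult_ac)
qed

text \<open>Pythagoras: constants are orthogonal to the centred point mass, whose squared norm is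
  \<open>(m - 1) / m\<close>.\<close>

lemma sum_centered_point_square:
  fixes a b :: real
  assumes "finite Y" "y \<in> Y"
  defines "m \<equiv> real (card Y)"
  shows "(\<Sum>x\<in>Y. (a / m + b * (of_bool (x = y) - 1 / m))\<^sup>2) = a\<^sup>2 / m + b\<^sup>2 * (m - 1) / m"
proof -
  have m0: "m \<noteq> 0"
    using assms by (auto simp: m_def)
  have one: "(\<Sum>x\<in>Y. of_bool (x = y)) = (1::real)"
    using assms by (simp add: of_bool_def)
  have "(a / m + b * (of_bool (x = y) - 1 / m))\<^sup>2
      = ((a - b) / m)\<^sup>2 + (b\<^sup>2 + 2 * b * (a - b) / m) * of_bool (x = y)" for x
    using m0 by (cases "x = y") (simp_all add: field_simps power2_eq_square)
  then have "(\<Sum>x\<in>Y. (a / m + b * (of_bool (x = y) - 1 / m))\<^sup>2)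
      = (\<Sum>x\<in>Y. ((a - b) / m)\<^sup>2 + (b\<^sup>2 + 2 * b * (a - b) / m) * of_bool (x = y))"
    by simp
  also have "\<dots> = m * ((a - b) / m)\<^sup>2 + (b\<^sup>2 + 2 * b * (a - b) / m)"
    by (simp add: sum.distrib one m_def flip: sum_distrib_left)
  also have "\<dots> = a\<^sup>2 / m + b\<^sup>2 * (m - 1) / m"
    using m0 by (simp add: field_simps power2_eq_square)
  finally show ?thesis .
qed

lemma sum_killed_square:
  assumes "finite X" "A \<subseteq> X" "y \<in> X - A" "k > 0"
  defines "m \<equiv> real (card (X - A))"
  shows "(\<Sum>x\<in>X. (killed X A y k x)\<^sup>2)
    = ((m - 1) ^ (2 * k) / m + (m - 1) / m) / (real (card X) - 1) ^ (2 * k)"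
proof -
  obtain j where j: "k = Suc j"
    using assms(4) gr0_conv_Suc by blast
  \<comment> \<open>Since \<open>k > 0\<close>, the coefficient vanishes on
    \<open>A\<close>.\<close>
  have "(\<Sum>x\<in>X. (killed X A y k x)\<^sup>2) = (\<Sum>x\<in>X - A. (killed X A y k x)\<^sup>2)"
    by (rule sum.mono_neutral_right) (use assms in \<open>auto simp: j\<close>)
  also have "\<dots> = (\<Sum>x\<in>X - A. ((m - 1) ^ k / m + (-1) ^ k * (of_bool (x = y) - 1 / m))\<^sup>2)
      / ((real (card X) - 1) ^ k)\<^sup>2"
    unfolding sum_divide_distrib m_def
    by (intro sum.cong refl) (simp only: killed_explicit[OF assms(1-3)] power_divide)
  also have "\<dots> = ((m - 1) ^ (2 * k) / m + (m - 1) / m) / (real (card X) - 1) ^ (2 * k)"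
    unfolding m_def by (subst sum_centered_point_square)
      (use assms in \<open>auto simp flip: power_mult simp: mult.commute\<close>)
  finally show ?thesis .
qed

text \<open>Without killing, the constant part is exactly the uniform distribution, so only the
  eigenvalue \<open>-1 / (n - 1)\<close> remains.\<close>

lemma sum_killed_empty_square:
  assumes "finite X" "y \<in> X"
  defines "n \<equiv> real (card X)"
  assumes "n \<noteq> 1"
  shows "n * (\<Sum>x\<in>X. (killed X {} y k x - 1 / n)\<^sup>2) = (n - 1) / (n - 1) ^ (2 * k)"
proof -
  have n: "n \<noteq> 0"
    using assms by (auto simp: n_def)
  \<comment> \<open>The term \<open>0 / n\<close> gives the shape of
    \<open>sum_centered_point_square\<close> with \<open>a = 0\<close>.\<close>
  have "killed X {} y k x - 1 / n = (0 / n + (-1) ^ k * (of_bool (x = y) - 1 / n)) / (n - 1) ^ k"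
    if "x \<in> X" for x
    using killed_explicit[of X "{}" y x k] that assms n
    by (simp add: n_def field_simps)
  then have "(\<Sum>x\<in>X. (killed X {} y k x - 1 / n)\<^sup>2)
      = (\<Sum>x\<in>X. (0 / n + (-1) ^ k * (of_bool (x = y) - 1 / n))\<^sup>2) / ((n - 1) ^ k)\<^sup>2"
    by (simp add: power_divide flip: sum_divide_distrib)
  also have "\<dots> = ((n - 1) / n) / (n - 1) ^ (2 * k)"
    unfolding n_def by (subst sum_centered_point_square)
      (use assms in \<open>auto simp flip: power_mult simp: mult.commute\<close>)
  finally show ?thesis
    using n by simp
qed

section \<open>From total variation to character coefficients\<close>

text \<open>Every event is controlled by the l1 distance, to which Cauchy-Schwarz applies.\<close>

lemma tv_dist_square_le:
  assumes "finite Y"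
  shows "(tv_dist Y p q)\<^sup>2 \<le> real (card Y) * (\<Sum>a\<in>Y. (norm (p a - q a))\<^sup>2)"
proof -
  let ?f = "\<lambda>A. norm ((\<Sum>a\<in>A. p a) - (\<Sum>a\<in>A. q a))"
  have "tv_dist Y p q \<in> ?f ` Pow Y"
    unfolding tv_dist_def by (rule Max_in) (use assms in auto)
  then obtain A where A: "A \<subseteq> Y" "tv_dist Y p q = ?f A"
    by auto
  have "?f A \<le> (\<Sum>a\<in>A. norm (p a - q a))"
    by (simp add: norm_sum flip: sum_subtractf)
  also have "\<dots> \<le> (\<Sum>a\<in>Y. norm (p a - q a))"
    using A assms by (intro sum_mono2) auto
  finally have "(tv_dist Y p q)\<^sup>2 \<le> (\<Sum>a\<in>Y. norm (p a - q a))\<^sup>2"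
    using A by (intro power_mono) auto
  also have "\<dots> \<le> (\<Sum>a\<in>Y. (norm (p a - q a))\<^sup>2) * card Y"
    by (rule sum_squared_le_sum_of_squares)
  finally show ?thesis by (simp add: mult.commute)
qed

text \<open>Plancherel is applied in the lamps for each fixed position. It leaves a factor
  \<open>1 / 2 ^ n\<close>, which turns the size \<open>2 ^ n * n\<close> of the state space into
  \<open>n\<close>.\<close>

lemma lamp_tv_dist_square_le:
  assumes "finite X" "\<omega>\<^sub>0 \<in> X \<rightarrow>\<^sub>E {0, 1}"
  shows "(tv_dist (lamp_states X) ((lamp_op X ^^ k) (point_mass (\<omega>\<^sub>0, y)))
      (\<lambda>_. 1 / (2 ^ card X * of_nat (card X))))\<^sup>2
    \<le> real (card X) * (\<Sum>A\<in>Pow X. \<Sum>x\<in>X. (killed X A y k x - of_bool (A = {}) / real (card X))\<^sup>2)"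
proof -
  define n where "n = card X"
  define u :: "('a \<Rightarrow> nat) \<times> 'a \<Rightarrow> complex" where "u = (\<lambda>_. 1 / (2 ^ n * of_nat n))"
  define f where "f = (lamp_op X ^^ k) (point_mass (\<omega>\<^sub>0, y))"
  define H where "H A x = killed X A y k x - of_bool (A = {}) / real n" for A x
  have diff: "f (\<omega>, x) - u (\<omega>, x)
      = complex_of_real (\<Sum>A\<in>Pow X. chi A \<omega> * (chi A \<omega>\<^sub>0 / 2 ^ n * H A x))"
    if "(\<omega>, x) \<in> lamp_states X" for \<omega> x
  proof -
    \<comment> \<open>The uniform distribution is constant in the lamps, so only the trivial
      character \<open>A = {}\<close> occurs in it.\<close>
    have "(\<Sum>A\<in>Pow X. chi A \<omega> * (chi A \<omega>\<^sub>0 / 2 ^ n * (of_bool (A = {}) / real n)))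
        = (\<Sum>A\<in>Pow X. if A = {} then 1 / (2 ^ n * real n) else 0)"
      by (rule sum.cong) (auto simp: chi_def)
    also have "\<dots> = 1 / (2 ^ n * real n)"
      using assms(1) by simp
    finally have "u (\<omega>, x) = complex_of_real
        (\<Sum>A\<in>Pow X. chi A \<omega> * (chi A \<omega>\<^sub>0 / 2 ^ n * (of_bool (A = {}) / real n)))"
      by (simp add: u_def)
    then show ?thesis
      unfolding f_def lamp_op_power_point_mass[OF assms that] H_def n_def
      by (simp only: of_real_diff[symmetric] sum_subtractf[symmetric] right_diff_distrib)
  qed
  have "(\<Sum>q\<in>lamp_states X. (norm (f q - u q))\<^sup>2)
      = (\<Sum>(\<omega>, x)\<in>(X \<rightarrow>\<^sub>E {0, 1}) \<times> X. (\<Sum>A\<in>Pow X. chi A \<omega> * (chi A \<omega>\<^sub>0 / 2 ^ n * H A x))\<^sup>2)"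
    by (rule sum.cong) (auto simp: lamp_states_def diff simp del: of_real_sum)
  also have "\<dots> = (\<Sum>\<omega>\<in>X \<rightarrow>\<^sub>E {0, 1}. \<Sum>x\<in>X. (\<Sum>A\<in>Pow X. chi A \<omega> * (chi A \<omega>\<^sub>0 / 2 ^ n * H A x))\<^sup>2)"
    by (simp only: sum.cartesian_product)
  also have "\<dots> = (\<Sum>x\<in>X. \<Sum>\<omega>\<in>X \<rightarrow>\<^sub>E {0, 1}. (\<Sum>A\<in>Pow X. chi A \<omega> * (chi A \<omega>\<^sub>0 / 2 ^ n * H A x))\<^sup>2)"
    by (rule sum.swap)
  also have "\<dots> = (\<Sum>x\<in>X. 2 ^ n * (\<Sum>A\<in>Pow X. (chi A \<omega>\<^sub>0 / 2 ^ n * H A x)\<^sup>2))"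
    unfolding chi_Plancherel[OF assms(1)] n_def ..
  also have "\<dots> = (\<Sum>x\<in>X. \<Sum>A\<in>Pow X. (H A x)\<^sup>2 / 2 ^ n)"
    unfolding sum_distrib_left
    by (intro sum.cong refl) (simp add: power_mult_distrib power_divide power2_eq_square)
  also have "\<dots> = (\<Sum>A\<in>Pow X. \<Sum>x\<in>X. (H A x)\<^sup>2 / 2 ^ n)"
    by (rule sum.swap)
  also have "\<dots> = (\<Sum>A\<in>Pow X. \<Sum>x\<in>X. (H A x)\<^sup>2) / 2 ^ n"
    by (simp flip: sum_divide_distrib)
  finally have "real (card (lamp_states X)) * (\<Sum>q\<in>lamp_states X. (norm (f q - u q))\<^sup>2)
      = real n * (\<Sum>A\<in>Pow X. \<Sum>x\<in>X. (H A x)\<^sup>2)"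
    by (simp add: card_lamp_states[OF assms(1)] n_def)
  then show ?thesis
    using tv_dist_square_le[OF finite_lamp_states[OF assms(1)], of f u]
    by (simp add: f_def u_def H_def n_def)
qed

section \<open>Estimates for the individual terms\<close>

lemma sum_killed_square_le:
  assumes "finite X" "A \<subseteq> X" "y \<in> X - A" "k > 0"
  defines "n \<equiv> real (card X)" and "a \<equiv> card A"
  assumes "n > 1"
  shows "n * (\<Sum>x\<in>X. (killed X A y k x)\<^sup>2) \<le> 2 * 2 ^ a * (1 - real a / (n - 1)) ^ (2 * k)"
proof -
  define m where "m = real (card (X - A))"
  have m: "m = n - real a"
    using assms by (simp add: m_def n_def a_def card_Diff_subset card_mono finite_subset)
  have "card (X - A) > 0"
    using assms by (auto simp: card_gt_0_iff)
  then have m1: "m \<ge> 1"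
    by (simp add: m_def)
  \<comment> \<open>As \<open>m - 1\<close> is an integer, it is 0 or at least 1. Hence the
    contribution of the eigenvalue \<open>-1\<close> is dominated by the main one, at the cost of a
    factor 2.\<close>
  have pow: "m - 1 \<le> (m - 1) ^ (2 * k)"
  proof (cases "m = 1")
    case False
    then have "m \<ge> 2"
      using m1 by (simp add: m_def)
    then show ?thesis
      using assms(4) by (intro self_le_power) auto
  qed simp
  \<comment> \<open>With \<open>n = m + a\<close>, this product equals
    \<open>(a + 1) * m - n\<close>. Then \<open>a + 1 \<le> 2 ^ a\<close> makes the bound geometric
    in \<open>a\<close>, ready for the binomial theorem.\<close>
  have "0 \<le> real a * (m - 1)"
    using m1 by simp
  then have "n \<le> (real a + 1) * m"
    by (simp add: m algebra_simps)
  also have "\<dots> \<le> 2 ^ a * m"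
    using m1 of_nat_mono[OF less_exp[of a, THEN Suc_leI], where 'a = real]
    by (intro mult_right_mono) auto
  finally have nm: "n / m \<le> 2 ^ a"
    using m1 by (simp add: divide_simps)
  have "n * (\<Sum>x\<in>X. (killed X A y k x)\<^sup>2)
      = n / m * (((m - 1) ^ (2 * k) + (m - 1)) / (n - 1) ^ (2 * k))"
    unfolding sum_killed_square[OF assms(1-4)] m_def[symmetric] n_def[symmetric]
    by (simp add: add_divide_distrib distrib_left mult_ac)
  also have "\<dots> \<le> 2 ^ a * ((2 * (m - 1) ^ (2 * k)) / (n - 1) ^ (2 * k))"
    using nm pow m1 \<open>n > 1\<close> by (intro mult_mono divide_right_mono) auto
  also have "\<dots> = 2 * 2 ^ a * ((m - 1) / (n - 1)) ^ (2 * k)"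
    by (simp add: power_divide)
  also have "(m - 1) / (n - 1) = 1 - real a / (n - 1)"
    using \<open>n > 1\<close> by (simp add: m field_simps)
  finally show ?thesis .
qed

text \<open>Use \<open>1 - u \<le> exp (- u)\<close> with \<open>u = a / (n - 1)\<close> and
  \<open>2 * k \<ge> (n - 1) * (ln n + c)\<close>. The bound on \<open>a\<close> keeps the base
  nonnegative.\<close>

lemma decay_le:
  fixes n c :: real
  assumes "real k \<ge> n / 2 * (ln n + c)" "n > 1" "c \<ge> 0" "real a \<le> n - 1"
  shows "(1 - real a / (n - 1)) ^ (2 * k) \<le> (exp (- c) / n) ^ a"
proof -
  have "(1 - real a / (n - 1)) ^ (2 * k) \<le> exp (- (real a / (n - 1))) ^ (2 * k)"
    using assms exp_ge_add_one_self[of "- (real a / (n - 1))"] by (intro power_mono) auto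
  also have "\<dots> = exp (- (real a * (2 * real k / (n - 1))))"
    by (simp flip: exp_of_nat_mult add: field_simps)
  also have "\<dots> \<le> exp (- (real a * (ln n + c)))"
  proof -
    have "ln n + c \<ge> 0"
      using assms by simp
    then have "(n - 1) * (ln n + c) \<le> n * (ln n + c)"
      by (intro mult_right_mono) auto
    also have "n * (ln n + c) = 2 * (n / 2 * (ln n + c))"
      by simp
    also have "\<dots> \<le> 2 * real k"
      using assms(1) by linarith
    finally have "ln n + c \<le> 2 * real k / (n - 1)"
      using assms by (simp add: pos_le_divide_eq mult.commute)
    then have "real a * (ln n + c) \<le> real a * (2 * real k / (n - 1))"
      by (intro mult_left_mono) auto
    then show ?thesis by simp
  qed
  also have "\<dots> = exp (real a * - (c + ln n))"
    by (simp add: algebra_simps)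
  also have "\<dots> = exp (- (c + ln n)) ^ a"
    by (rule exp_of_nat_mult)
  also have "exp (- (c + ln n)) = exp (- c) / n"
    using assms by (simp add: exp_diff)
  finally show ?thesis .
qed

text \<open>With \<open>u = n * t\<close>, multiplying \<open>1 - u \<le> exp (- u)\<close> by
  \<open>exp u\<close> yields \<open>exp u - 1 \<le> u * exp u\<close>.\<close>

lemma power_one_add_minus_one_le:
  fixes t :: real
  assumes "0 \<le> t" "real n * t \<le> s"
  shows "(1 + t) ^ n - 1 \<le> real n * t * exp s"
proof -
  have "(1 + t) ^ n \<le> exp t ^ n"
    using assms by (intro power_mono) auto
  also have "\<dots> = exp (real n * t)"
    by (simp add: exp_of_nat_mult)
  also have "\<dots> - 1 \<le> real n * t * exp (real n * t)"
    using mult_right_mono[OF exp_ge_add_one_self[of "- (real n * t)"], of "exp (real n * t)"]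
    by (simp add: algebra_simps flip: exp_add)
  also have "\<dots> \<le> real n * t * exp s"
    using assms by (intro mult_left_mono) auto
  finally show ?thesis by simp
qed

text \<open>For \<open>n \<ge> 3\<close> the base \<open>n - 1\<close> is at least 2, and
  \<open>2 * k \<ge> 3 * c\<close> makes \<open>2 ^ (2 * k)\<close> exceed \<open>exp c\<close>. For
  \<open>n = 2\<close> the left side is 1 for every \<open>k\<close>.\<close>

lemma parity_term_le:
  fixes n c :: real
  assumes "n \<ge> 3" "c \<ge> 0" "real k \<ge> n / 2 * (ln n + c)" "k > 0"
  shows "(n - 1) / (n - 1) ^ (2 * k) \<le> 2 * exp (- c)"
proof -
  have "1 / 2 \<le> ln (2::real)"
    using ln_le_minus_one[of "1 / 2 :: real"] by (simp add: ln_div)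
  then have "c \<le> 3 * c * ln 2"
    using mult_left_mono[of "1 / 2" "ln 2" "3 * c"] assms by simp
  also have "3 * c \<le> 2 * real k"
  proof -
    have "3 * c \<le> n * c"
      using assms by (intro mult_right_mono)
    also have "\<dots> \<le> n * (ln n + c)"
      using assms by (intro mult_left_mono) auto
    also have "\<dots> = 2 * (n / 2 * (ln n + c))"
      by simp
    also have "\<dots> \<le> 2 * real k"
      using assms(3) by linarith
    finally show ?thesis .
  qed
  then have "3 * c * ln 2 \<le> 2 * real k * ln 2"
    by (intro mult_right_mono) auto
  finally have "exp c \<le> exp (real (2 * k) * ln 2)"
    by simp
  also have "\<dots> = 2 ^ (2 * k)"
    by (simp only: exp_of_nat_mult) simp
  also have "\<dots> = 2 * 2 ^ (2 * k - 1)"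
    using assms by (simp flip: power_Suc)
  also have "\<dots> \<le> 2 * (n - 1) ^ (2 * k - 1)"
    using assms by (intro mult_left_mono power_mono) auto
  also have "\<dots> = 2 * ((n - 1) ^ (2 * k) / (n - 1))"
    using assms by (simp add: power_diff)
  finally show ?thesis
    using assms by (simp add: exp_minus field_simps)
qed

section \<open>Summation over all characters\<close>

text \<open>The sets \<open>A\<close> are split into the empty one, the nonempty ones avoiding
  \<open>y\<close>, and those containing \<open>y\<close>. The first two kinds contribute 2 and
  \<open>4 * exp 2\<close> to the constant, the last nothing.\<close>

lemma lamp_tv_dist_bound:
  assumes X: "finite X" "card X \<ge> 3" and \<omega>\<^sub>0: "\<omega>\<^sub>0 \<in> X \<rightarrow>\<^sub>E {0, 1}" and y: "y \<in> X"
    and c: "c \<ge> 0" and k: "real k \<ge> real (card X) / 2 * (ln (real (card X)) + c)"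
  shows "(tv_dist (lamp_states X) ((lamp_op X ^^ k) (point_mass (\<omega>\<^sub>0, y)))
      (\<lambda>_. 1 / (2 ^ card X * of_nat (card X))))\<^sup>2 \<le> (2 + 4 * exp 2) * exp (- c)"
proof -
  define n where "n = real (card X)"
  \<comment> \<open>The 2 in \<open>t\<close> absorbs the factor \<open>2 ^ card A\<close> of
    \<open>sum_killed_square_le\<close>.\<close>
  define t where "t = 2 * (exp (- c) / n)"
  have n: "n \<ge> 3"
    using X by (simp add: n_def)
  have "0 < n / 2 * (ln n + c)"
    using n c by (intro mult_pos_pos add_pos_nonneg) auto
  then have k0: "k > 0"
    using k by (simp add: n_def)
  let ?T = "\<lambda>A. n * (\<Sum>x\<in>X. (killed X A y k x - of_bool (A = {}) / n)\<^sup>2)"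
  have empty: "?T {} \<le> 2 * exp (- c)"
    using sum_killed_empty_square[OF X(1) y, of k] parity_term_le[OF n c _ k0] k n
    by (simp add: n_def)
  have nonempty: "?T A \<le> 2 * t ^ card A" if "A \<in> Pow (X - {y}) - {{}}" for A
  proof -
    have A: "A \<subseteq> X" "y \<in> X - A" "A \<noteq> {}"
      using that y by auto
    have "card A < card X"
      using A X(1) by (intro psubset_card_mono) auto
    then have "real (card A) \<le> n - 1"
      by (simp add: n_def)
    then have decay: "(1 - real (card A) / (n - 1)) ^ (2 * k) \<le> (exp (- c) / n) ^ card A"
      using k n c by (intro decay_le) (auto simp: n_def)
    have "?T A = n * (\<Sum>x\<in>X. (killed X A y k x)\<^sup>2)"
      using A by simp
    also have "\<dots> \<le> 2 * 2 ^ card A * (1 - real (card A) / (n - 1)) ^ (2 * k)"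
      unfolding n_def using A X k0 by (intro sum_killed_square_le) auto
    also have "\<dots> \<le> 2 * 2 ^ card A * (exp (- c) / n) ^ card A"
      using decay by (intro mult_left_mono) auto
    also have "\<dots> = 2 * t ^ card A"
      unfolding t_def power_mult_distrib by simp
    finally show ?thesis .
  qed
  \<comment> \<open>The walk is killed at its start, and \<open>k > 0\<close> makes this visible in
    the coefficient.\<close>
  have start: "?T A = 0" if "A \<in> Pow X - Pow (X - {y})" for A
  proof -
    have "y \<in> A" "A \<noteq> {}"
      using that by auto
    moreover obtain j where "k = Suc j"
      using k0 gr0_conv_Suc by blast
    ultimately show ?thesis
      by (simp add: killed_start_in del: killed.simps)
  qed
  have "(\<Sum>A\<in>Pow (X - {y}). t ^ card A) = (1 + t) ^ (card X - 1)"
    using sum_prod_Pow[of "X - {y}" "\<lambda>_. t"] X(1) y by simp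
  moreover have "(\<Sum>A\<in>Pow (X - {y}). t ^ card A) = 1 + (\<Sum>A\<in>Pow (X - {y}) - {{}}. t ^ card A)"
    using X(1) by (subst sum.remove[of _ "{}"]) auto
  ultimately have "(\<Sum>A\<in>Pow (X - {y}) - {{}}. t ^ card A) = (1 + t) ^ (card X - 1) - 1"
    by simp
  \<comment> \<open>The exponent 2 comes from \<open>n * t = 2 * exp (- c) \<le> 2\<close>.\<close>
  also have "\<dots> \<le> real (card X - 1) * t * exp 2"
  proof (rule power_one_add_minus_one_le)
    show "0 \<le> t"
      using n by (simp add: t_def)
    then have "real (card X - 1) * t \<le> n * t"
      by (intro mult_right_mono) (auto simp: n_def)
    also have "\<dots> \<le> 2"
      using n c by (simp add: t_def)
    finally show "real (card X - 1) * t \<le> 2" .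
  qed
  also have "\<dots> \<le> n * t * exp 2"
    using n by (intro mult_right_mono) (auto simp: n_def t_def)
  also have "\<dots> = 2 * exp (- c) * exp 2"
    using n by (simp add: t_def)
  finally have rest: "(\<Sum>A\<in>Pow (X - {y}) - {{}}. t ^ card A) \<le> 2 * exp (- c) * exp 2" .
  have "(tv_dist (lamp_states X) ((lamp_op X ^^ k) (point_mass (\<omega>\<^sub>0, y)))
      (\<lambda>_. 1 / (2 ^ card X * of_nat (card X))))\<^sup>2 \<le> (\<Sum>A\<in>Pow X. ?T A)"
    using lamp_tv_dist_square_le[OF X(1) \<omega>\<^sub>0, of k y]
    by (simp add: n_def flip: sum_distrib_left)
  also have "\<dots> = (\<Sum>A\<in>Pow (X - {y}). ?T A)"
    using X(1) start by (intro sum.mono_neutral_right) auto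
  also have "\<dots> = ?T {} + (\<Sum>A\<in>Pow (X - {y}) - {{}}. ?T A)"
    using X(1) by (subst sum.remove[of _ "{}"]) auto
  also have "\<dots> \<le> 2 * exp (- c) + (\<Sum>A\<in>Pow (X - {y}) - {{}}. 2 * t ^ card A)"
    by (intro add_mono empty sum_mono nonempty)
  also have "\<dots> \<le> 2 * exp (- c) + 2 * (2 * exp (- c) * exp 2)"
    using rest by (simp flip: sum_distrib_left)
  finally show ?thesis
    by (simp add: algebra_simps)
qed

text \<open>Convergence fails for smaller \<open>n\<close>: with two points the position alternates
  deterministically, and with one point there are no neighbours.\<close>

theorem proposition4p1:
  "\<exists>C::real. C > 0 \<and>
     (\<forall>(n::nat) (k::nat) (c::real) (\<omega>\<^sub>0 :: nat \<Rightarrow> nat) (y::nat).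
        n \<ge> 3 \<longrightarrow> c \<ge> 0 \<longrightarrow> real k \<ge> real n / 2 * (ln (real n) + c) \<longrightarrow>
        \<omega>\<^sub>0 \<in> {1..n} \<rightarrow>\<^sub>E {0, 1} \<longrightarrow> y \<in> {1..n} \<longrightarrow>
        (tv_dist (lamp_states {1..n})
           ((lamp_op {1..n} ^^ k) (point_mass (\<omega>\<^sub>0, y)))
           (\<lambda>_. 1 / (2 ^ n * of_nat n)))\<^sup>2 \<le> C * exp (- c))"
proof (intro exI[of _ "2 + 4 * exp 2"] conjI allI impI)
  show "0 < 2 + 4 * exp (2::real)"
    by (simp add: add_pos_pos)
next
  fix n k :: nat and c :: real and \<omega>\<^sub>0 :: "nat \<Rightarrow> nat" and y :: nat
  assume "n \<ge> 3" "c \<ge> 0" "real k \<ge> real n / 2 * (ln (real n) + c)"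
    "\<omega>\<^sub>0 \<in> {1..n} \<rightarrow>\<^sub>E {0, 1}" "y \<in> {1..n}"
  then show "(tv_dist (lamp_states {1..n}) ((lamp_op {1..n} ^^ k) (point_mass (\<omega>\<^sub>0, y)))
      (\<lambda>_. 1 / (2 ^ n * of_nat n)))\<^sup>2 \<le> (2 + 4 * exp 2) * exp (- c)"
    using lamp_tv_dist_bound[of "{1..n}" \<omega>\<^sub>0 y c k] by simp
qed

end
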